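(* Let $X$ be a Banach space, let $T\in B(X)$, and assume that there exists a dense set $X_0\subset X$ such that $T^nx\to0$ as $n\to\infty$ for all $x\in X_0$. Then the following assertions are equivalent: (i) $T$ is Li-Yorke chaotic; (ii) $T$ is reiteratively distributionally chaotic of type $1^+$.
   Context: $B(X)$ is the space of bounded linear operators $X\to X$. $T$ is Li-Yorke chaotic if there is an uncountable set $\Gamma\subset X$ such that for every pair $(x,y)\in\Gamma\times\Gamma$ of distinct points, $\liminf_{n\to\infty}\|T^nx-T^ny\|=0$ and $\limsup_{n\to\infty}\|T^nx-T^ny\|>0$. For $A\subset\mathbb N$: $\overline{\mathrm{dens}}(A)=\limsup_{n\to\infty}\frac{\mathrm{card}(A\cap[1,n])}{n}$ and $\underline{\mathrm{Bd}}(A)=\lim_{n\to\infty}\liminf_{m\to\infty}\frac{\mathrm{card}(A\cap[m+1,m+n])}{n}$. For $x,y\in X$ and $\delta>0$ put $D_{x,y}(\delta)=\{j\in\mathbb N:\|T^jx-T^jy\|<\delta\}$, $F^*_{x,y}(\delta)=\overline{\mathrm{dens}}(D_{x,y}(\delta))$, $BF_{x,y}(\delta)=\underline{\mathrm{Bd}}(D_{x,y}(\delta))$. $T$ is reiteratively distributionally chaotic of type $1^+$ if there exist an uncountable $\Gamma\subset X$ and $\varepsilon>0$ such that for all distinct $x,y\in\Gamma$, $BF_{x,y}(\varepsilon)=0$ and $F^*_{x,y}(\delta)=1$ for all $\delta>0$. *)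

theory Defs
  imports "HOL-Analysis.Analysis"
begin

text \<open>
  Upper and lower limits are taken in the extended reals, since the orbit distances
  need not be bounded. At index \<open>n = 0\<close> the quotients below are \<open>0 / 0 = 0\<close>, which does
  not affect any limit. Neither density depends on whether \<open>0\<close> belongs to the set.
\<close>

definition upper_density :: "nat set \<Rightarrow> ereal" where
  "upper_density A = limsup (\<lambda>n. ereal (real (card (A \<inter> {1..n})) / real n))"

text \<open>
  The outer limit always exists: the inner lower limit, multiplied by \<open>n\<close>, is
  superadditive in \<open>n\<close>, so Fekete's lemma applies.
\<close>

definition lower_Banach_density :: "nat set \<Rightarrow> ereal" where
  "lower_Banach_density A =
     lim (\<lambda>n. liminf (\<lambda>m. ereal (real (card (A \<inter> {m + 1..m + n})) / real n)))"

definition close_times ::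
    "('a::real_normed_vector \<Rightarrow> 'a) \<Rightarrow> 'a \<Rightarrow> 'a \<Rightarrow> real \<Rightarrow> nat set" where
  "close_times T x y \<delta> = {j. norm ((T ^^ j) x - (T ^^ j) y) < \<delta>}"

definition Li_Yorke_chaotic :: "('a::real_normed_vector \<Rightarrow> 'a) \<Rightarrow> bool" where
  "Li_Yorke_chaotic T \<longleftrightarrow>
     (\<exists>\<Gamma>. uncountable \<Gamma> \<and>
        (\<forall>x\<in>\<Gamma>. \<forall>y\<in>\<Gamma>. x \<noteq> y \<longrightarrow>
           liminf (\<lambda>n. ereal (norm ((T ^^ n) x - (T ^^ n) y))) = 0 \<and>
           limsup (\<lambda>n. ereal (norm ((T ^^ n) x - (T ^^ n) y))) > 0))"

text \<open>Reiterative distributional chaos of type \<open>1\<^sup>+\<close>; \<open>\<epsilon>\<close> is uniform over all pairs.\<close>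

definition reiteratively_distributionally_chaotic_1plus ::
    "('a::real_normed_vector \<Rightarrow> 'a) \<Rightarrow> bool" where
  "reiteratively_distributionally_chaotic_1plus T \<longleftrightarrow>
     (\<exists>\<Gamma>. \<exists>\<epsilon>>0. uncountable \<Gamma> \<and>
        (\<forall>x\<in>\<Gamma>. \<forall>y\<in>\<Gamma>. x \<noteq> y \<longrightarrow>
           lower_Banach_density (close_times T x y \<epsilon>) = 0 \<and>
           (\<forall>\<delta>>0. upper_density (close_times T x y \<delta>) = 1)))"

end

theory Submission
  imports Defs
begin

text \<open>
  If \<open>T\<close> is Li--Yorke chaotic, then the difference of two points of the scrambled set has an
  orbit that comes arbitrarily close to \<open>0\<close> without converging to \<open>0\<close>, which is impossible
  for a power bounded operator. Hence, by the uniform boundedness principle, the vectors with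
  unbounded orbit are residual. The vectors whose orbit is close to \<open>0\<close> along a set of upper
  density \<open>1\<close> form a \<open>G\<^sub>\<delta>\<close> set containing \<open>X\<^sub>0\<close>, so they are residual as well. By Baire some \<open>z\<close> has
  both properties, and the line spanned by \<open>z\<close> is the required uncountable set: since \<open>T\<close>
  expands norms by a bounded factor, a very large value of \<open>\<parallel>T\<^sup>n z\<parallel>\<close> is preceded by a long
  window of times at which the orbit stays away from \<open>0\<close>, so unboundedness of the orbit makes the
  lower Banach density of the close times vanish.
\<close>

section \<open>Limits and densities\<close>

lemma frequently_ge_imp_le_Limsup:
  fixes f :: "'b \<Rightarrow> 'c::complete_linorder"
  assumes "\<exists>\<^sub>F x in F. c \<le> f x"
  shows "c \<le> Limsup F f"
  using assms Limsup_lessD[of F f c] unfolding frequently_def not_le by (meson not_le)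

lemma frequently_le_imp_Liminf_le:
  fixes f :: "'b \<Rightarrow> 'c::complete_linorder"
  assumes "\<exists>\<^sub>F x in F. f x \<le> c"
  shows "Liminf F f \<le> c"
  using assms less_LiminfD[of c F f] unfolding frequently_def not_le by (meson not_le)

lemma card_inter_interval_le: "card (A \<inter> {1..n::nat}) \<le> n"
  using card_mono[of "{1..n}" "A \<inter> {1..n}"] by simp

lemma upper_density_le_1: "upper_density A \<le> 1"
  unfolding upper_density_def
proof (rule Limsup_bounded, rule always_eventually, rule allI)
  fix n
  show "ereal (real (card (A \<inter> {1..n})) / real n) \<le> 1"
    using card_inter_interval_le[of A n] by (cases "n = 0") (auto simp: divide_simps)
qed

text \<open>For fixed \<open>e\<close> and \<open>N\<close> the criterion asks for a single
  \<open>n\<close> and so inspects only finitely many times. This is what turns it into an open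
  condition on the starting vector later on.\<close>

lemma upper_density_eq_1I:
  assumes "\<And>e N. e > 0 \<Longrightarrow> \<exists>n\<ge>N. (1 - e) * real n \<le> real (card (A \<inter> {1..n}))"
  shows "upper_density A = 1"
proof (rule antisym[OF upper_density_le_1])
  have ge: "ereal (1 - e) \<le> upper_density A" if "e > 0" for e
    unfolding upper_density_def
  proof (rule frequently_ge_imp_le_Limsup, unfold frequently_sequentially, intro allI)
    fix N
    obtain n where n: "n \<ge> max N 1" "(1 - e) * real n \<le> real (card (A \<inter> {1..n}))"
      \<comment> \<open>At \<open>n = 0\<close> the product inequality holds trivially but the
        quotient is \<open>0\<close>, hence the bound \<open>max N 1\<close>.\<close>
      using assms \<open>e > 0\<close> by blast
    then show "\<exists>n\<ge>N. ereal (1 - e) \<le> ereal (real (card (A \<inter> {1..n})) / real n)"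
      by (intro exI[of _ n]) (auto simp: pos_le_divide_eq)
  qed
  show "1 \<le> upper_density A"
  proof (rule ereal_le_epsilon2)
    fix e :: real
    assume "e > 0"
    have "1 = ereal (1 - e) + ereal e" by simp
    also have "\<dots> \<le> upper_density A + ereal e"
      by (intro add_right_mono ge \<open>e > 0\<close>)
    finally show "1 \<le> upper_density A + ereal e" .
  qed
qed

text \<open>Used in contrapositive form: close times of upper density 1 form an infinite
  set.\<close>

lemma upper_density_finite:
  assumes "finite A"
  shows "upper_density A = 0"
proof -
  have "(\<lambda>n. real (card (A \<inter> {1..n})) / real n) \<longlonglongrightarrow> 0"
  proof (rule tendsto_sandwich[of "\<lambda>_. 0"])
    show "(\<lambda>n. real (card A) / real n) \<longlonglongrightarrow> 0"
      by (rule lim_const_over_n)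
    show "\<forall>\<^sub>F n in sequentially. real (card (A \<inter> {1..n})) / real n \<le> real (card A) / real n"
      by (intro always_eventually allI divide_right_mono of_nat_mono card_mono assms) auto
  qed auto
  then have "(\<lambda>n. ereal (real (card (A \<inter> {1..n})) / real n)) \<longlonglongrightarrow> ereal 0"
    by (rule tendsto_ereal)
  then show ?thesis
    unfolding upper_density_def by (simp add: lim_imp_Limsup zero_ereal_def)
qed

text \<open>Windows of length \<open>n\<close> that miss \<open>A\<close> and start arbitrarily late
  make the inner lower limit vanish for every \<open>n\<close>, so the outer limit is that of a
  constant sequence.\<close>

lemma lower_Banach_density_eq_0I:
  assumes "\<And>M n. \<exists>m\<ge>M. A \<inter> {m + 1..m + n} = {}"
  shows "lower_Banach_density A = 0"
proof -
  have "liminf (\<lambda>m. ereal (real (card (A \<inter> {m + 1..m + n})) / real n)) = 0" for n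
  proof (rule antisym)
    show "liminf (\<lambda>m. ereal (real (card (A \<inter> {m + 1..m + n})) / real n)) \<le> 0"
    proof (rule frequently_le_imp_Liminf_le, unfold frequently_sequentially, intro allI)
      fix M
      obtain m where "m \<ge> M" "A \<inter> {m + 1..m + n} = {}"
        using assms by blast
      then show "\<exists>m\<ge>M. ereal (real (card (A \<inter> {m + 1..m + n})) / real n) \<le> 0"
        by (intro exI[of _ m]) (simp add: zero_ereal_def)
    qed
    show "0 \<le> liminf (\<lambda>m. ereal (real (card (A \<inter> {m + 1..m + n})) / real n))"
      by (intro Liminf_bounded always_eventually) simp
  qed
  then show ?thesis
    unfolding lower_Banach_density_def by (simp add: limI)
qed

text \<open>Used in contrapositive form: lower Banach density 0 leaves infinitely many times outside
  the set.\<close>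

lemma lower_Banach_density_cofinite:
  assumes "finite (- A)"
  shows "lower_Banach_density A = 1"
proof -
  obtain N where N: "\<And>j. j > N \<Longrightarrow> j \<in> A"
    using assms unfolding finite_nat_set_iff_bounded_le by (meson ComplI not_le)
  \<comment> \<open>For \<open>n = 0\<close> the quotient is \<open>0 / 0 = 0\<close>; the outer
    limit ignores this index.\<close>
  have "liminf (\<lambda>m. ereal (real (card (A \<inter> {m + 1..m + n})) / real n)) = 1" if "n \<ge> 1" for n
  proof -
    have "A \<inter> {m + 1..m + n} = {m + 1..m + n}" if "m \<ge> N" for m
      using N that by auto
    then have "\<forall>\<^sub>F m in sequentially.
        ereal (real (card (A \<inter> {m + 1..m + n})) / real n) = 1"
      using \<open>n \<ge> 1\<close> by (intro eventually_sequentiallyI[of N]) simp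
    then show ?thesis
      by (subst Liminf_eq[where g = "\<lambda>_. 1"]) (auto simp: Liminf_const)
  qed
  then have "\<forall>\<^sub>F n in sequentially.
      liminf (\<lambda>m. ereal (real (card (A \<inter> {m + 1..m + n})) / real n)) = 1"
    by (rule eventually_sequentiallyI)
  then show ?thesis
    unfolding lower_Banach_density_def by (intro limI tendsto_eventually)
qed

section \<open>Orbits of bounded operators\<close>

lemma bounded_linear_funpow:
  fixes T :: "'a::real_normed_vector \<Rightarrow> 'a"
  assumes "bounded_linear T"
  shows "bounded_linear (T ^^ n)"
proof (induction n)
  case 0
  show ?case by (simp add: id_def)
next
  case (Suc n)
  then show ?case
    using bounded_linear_compose[OF assms] by (simp add: comp_def)
qed

lemma linear_funpow_diff:
  fixes T :: "'a::real_normed_vector \<Rightarrow> 'a"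
  assumes "bounded_linear T"
  shows "(T ^^ n) (x - y) = (T ^^ n) x - (T ^^ n) y"
  by (rule linear_diff[OF bounded_linear.linear[OF bounded_linear_funpow[OF assms]]])

lemma close_times_diff:
  assumes "bounded_linear T"
  shows "close_times T x y \<delta> = close_times T (x - y) 0 \<delta>"
  unfolding close_times_def
  by (simp add: linear_funpow_diff[OF assms]
      linear_0[OF bounded_linear.linear[OF bounded_linear_funpow[OF assms]]])

lemma close_times_zero:
  assumes "bounded_linear T"
  shows "close_times T x 0 \<delta> = {j. norm ((T ^^ j) x) < \<delta>}"
  unfolding close_times_def
  by (simp add: linear_0[OF bounded_linear.linear[OF bounded_linear_funpow[OF assms]]])

text \<open>Taking \<open>C \<ge> 1\<close> makes \<open>C ^ n\<close> increasing in
  \<open>n\<close>, so one power bounds the growth over all shorter stretches of an orbit.\<close>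

lemma funpow_norm_bound:
  fixes T :: "'a::real_normed_vector \<Rightarrow> 'a"
  assumes "bounded_linear T"
  obtains C where "C \<ge> 1" "\<And>n x. norm ((T ^^ n) x) \<le> C ^ n * norm x"
proof -
  obtain K where K: "K > 0" "\<And>x. norm (T x) \<le> norm x * K"
    using bounded_linear.pos_bounded[OF assms] by blast
  define C where "C = max K 1"
  have step: "norm (T x) \<le> C * norm x" for x
    using K(2)[of x] mult_left_mono[of K C "norm x"] unfolding C_def
    by (simp add: mult.commute)
  have "norm ((T ^^ n) x) \<le> C ^ n * norm x" for n x
  proof (induction n)
    case (Suc n)
    have "norm ((T ^^ Suc n) x) \<le> C * norm ((T ^^ n) x)"
      using step by simp
    also have "\<dots> \<le> C * (C ^ n * norm x)"
      using Suc by (intro mult_left_mono) (auto simp: C_def)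
    finally show ?case by (simp add: mult.assoc)
  qed simp
  then show thesis
    using that[of C] by (simp add: C_def)
qed

text \<open>
  The window of length \<open>n\<close> is the one just before a time \<open>N\<close> at which the orbit exceeds \<open>C ^ n * \<epsilon>\<close>;
  the norms at the times up to \<open>M + n\<close> are added to the threshold to force \<open>N > M + n\<close>.
\<close>

lemma unbounded_orbit_long_far_windows:
  fixes T :: "'a::real_normed_vector \<Rightarrow> 'a"
  assumes T: "bounded_linear T" and unb: "\<And>B. \<exists>n. norm ((T ^^ n) z) > B" and "\<epsilon> > 0"
  shows "\<exists>m\<ge>M. \<forall>j\<in>{m + 1..m + n}. \<epsilon> \<le> norm ((T ^^ j) z)"
proof -
  obtain C where C: "C \<ge> 1" "\<And>n x. norm ((T ^^ n) x) \<le> C ^ n * norm x"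
    using funpow_norm_bound[OF T] by blast
  obtain N where N: "norm ((T ^^ N) z) > C ^ n * \<epsilon> + (\<Sum>j\<le>M + n. norm ((T ^^ j) z))"
    using unb by blast
  have "N > M + n"
  proof (rule ccontr)
    assume "\<not> N > M + n"
    then have "norm ((T ^^ N) z) \<le> (\<Sum>j\<le>M + n. norm ((T ^^ j) z))"
      by (intro member_le_sum) auto
    moreover have "C ^ n * \<epsilon> \<ge> 0"
      using C(1) \<open>\<epsilon> > 0\<close> by simp
    ultimately show False
      using N by simp
  qed
  \<comment> \<open>Since \<open>N > M + n\<close>, the subtraction does not truncate and the window
    ends exactly at \<open>N\<close>. From \<open>j\<close> to \<open>N\<close> there are fewer than
    \<open>n\<close> steps.\<close>
  have "\<epsilon> \<le> norm ((T ^^ j) z)" if j: "j \<in> {N - n + 1..N - n + n}" for j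
  proof -
    have "(\<Sum>j\<le>M + n. norm ((T ^^ j) z)) \<ge> 0"
      by (rule sum_nonneg) simp
    then have "C ^ n * \<epsilon> \<le> norm ((T ^^ N) z)"
      using N by simp
    also have "(T ^^ N) z = (T ^^ (N - j)) ((T ^^ j) z)"
      using j \<open>N > M + n\<close> by (simp flip: funpow_add[THEN fun_cong, unfolded comp_def])
    also have "norm \<dots> \<le> C ^ (N - j) * norm ((T ^^ j) z)"
      by (rule C(2))
    also have "\<dots> \<le> C ^ n * norm ((T ^^ j) z)"
      using C(1) j by (intro mult_right_mono power_increasing) auto
    finally show ?thesis
      using C(1) by simp
  qed
  then show ?thesis
    using \<open>N > M + n\<close> by (intro exI[of _ "N - n"]) auto
qed

text \<open>A single small orbit value \<open>(T ^^ n) u\<close> controls the whole tail, because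
  \<open>(T ^^ m) u\<close> is the image of it under \<open>T ^^ (m - n)\<close>.\<close>

lemma power_bounded_liminf_limsup:
  fixes T :: "'a::real_normed_vector \<Rightarrow> 'a"
  assumes bdd: "\<And>n x. norm ((T ^^ n) x) \<le> C * norm x"
    and liminf: "liminf (\<lambda>n. ereal (norm ((T ^^ n) u))) = 0"
  shows "limsup (\<lambda>n. ereal (norm ((T ^^ n) u))) = 0"
proof (rule antisym)
  show "limsup (\<lambda>n. ereal (norm ((T ^^ n) u))) \<le> 0"
  proof (rule ereal_le_epsilon2)
    fix e :: real
    assume "e > 0"
    \<comment> \<open>The denominator is positive whatever the sign of \<open>C\<close>.\<close>
    define d where "d = e / (\<bar>C\<bar> + 1)"
    have "d > 0"
      using \<open>e > 0\<close> by (simp add: d_def add_nonneg_pos)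
    have "\<exists>\<^sub>F n in sequentially. ereal (norm ((T ^^ n) u)) < ereal d"
    proof (rule ccontr)
      assume "\<not> ?thesis"
      then have "\<forall>\<^sub>F n in sequentially. ereal d \<le> ereal (norm ((T ^^ n) u))"
        by (simp add: not_frequently not_less)
      then have "ereal d \<le> 0"
        unfolding liminf[symmetric] by (rule Liminf_bounded)
      then show False
        using \<open>d > 0\<close> by simp
    qed
    then obtain n where n: "norm ((T ^^ n) u) < d"
      using frequently_ex by fastforce
    have "ereal (norm ((T ^^ m) u)) \<le> ereal e" if "m \<ge> n" for m
    proof -
      have "(T ^^ m) u = (T ^^ (m - n)) ((T ^^ n) u)"
        using that by (simp flip: funpow_add[THEN fun_cong, unfolded comp_def])
      then have "norm ((T ^^ m) u) \<le> C * norm ((T ^^ n) u)"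
        using bdd by simp
      also have "\<dots> \<le> (\<bar>C\<bar> + 1) * d"
        using n by (intro mult_mono) auto
      also have "\<dots> = e"
        by (simp add: d_def add_nonneg_pos less_imp_neq[THEN not_sym])
      finally show ?thesis by simp
    qed
    then have "\<forall>\<^sub>F m in sequentially. ereal (norm ((T ^^ m) u)) \<le> ereal e"
      by (rule eventually_sequentiallyI)
    then have "limsup (\<lambda>n. ereal (norm ((T ^^ n) u))) \<le> ereal e"
      by (rule Limsup_bounded)
    then show "limsup (\<lambda>n. ereal (norm ((T ^^ n) u))) \<le> 0 + ereal e"
      by simp
  qed
  show "0 \<le> limsup (\<lambda>n. ereal (norm ((T ^^ n) u)))"
    by (rule le_Limsup) auto
qed

section \<open>Residual sets of vectors\<close>

lemma Baire_category_open_dense: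
  fixes U :: "nat \<Rightarrow> 'a::banach set"
  assumes "\<And>n. open (U n)" "\<And>n. closure (U n) = UNIV"
  shows "closure (\<Inter>n. U n) = UNIV"
proof -
  have "Met_TC.mcomplete TYPE('a)"
    by (simp add: complete_UNIV)
  then show ?thesis
    using Met_TC.metric_Baire_category[of "range U"] assms by auto
qed

lemma open_orbit_exceeds:
  fixes T :: "'a::real_normed_vector \<Rightarrow> 'a"
  assumes "bounded_linear T"
  shows "open {z. \<exists>n. norm ((T ^^ n) z) > B}"
proof -
  have "open {z. norm ((T ^^ n) z) > B}" for n
    by (intro open_Collect_less continuous_intros
        bounded_linear.continuous_on[OF bounded_linear_funpow[OF assms]])
  then have "open (\<Union>n. {z. norm ((T ^^ n) z) > B})"
    by blast
  moreover have "{z. \<exists>n. norm ((T ^^ n) z) > B} = (\<Union>n. {z. norm ((T ^^ n) z) > B})"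
    by blast
  ultimately show ?thesis
    by simp
qed

text \<open>This is the last step of the uniform boundedness principle: off the closure there is a
  ball on which all orbits are bounded by \<open>B\<close>, and linearity moves this bound to the
  origin.\<close>

lemma not_dense_orbit_exceeds_imp_power_bounded:
  fixes T :: "'a::real_normed_vector \<Rightarrow> 'a"
  assumes T: "bounded_linear T" and "closure {z. \<exists>n. norm ((T ^^ n) z) > B} \<noteq> UNIV"
  obtains C where "\<And>n x. norm ((T ^^ n) x) \<le> C * norm x"
proof -
  obtain a where "a \<notin> closure {z. \<exists>n. norm ((T ^^ n) z) > B}"
    using assms(2) by blast
  then obtain r where "r > 0" and r: "\<And>z. dist z a < r \<Longrightarrow> \<not> (\<exists>n. norm ((T ^^ n) z) > B)"
    unfolding closure_approachable by blast
  have "norm ((T ^^ n) x) \<le> (4 * B / r) * norm x" for n x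
  proof (cases "x = 0")
    case True
    then show ?thesis
      by (simp add: linear_0[OF bounded_linear.linear[OF bounded_linear_funpow[OF T]]])
  next
    case False
    \<comment> \<open>With this scale \<open>a + t *\<^sub>R x\<close> has distance
      \<open>r / 2\<close> from \<open>a\<close>. The bound \<open>2 * B\<close> for
      \<open>t * norm ((T ^^ n) x)\<close> then yields the constant
      \<open>4 * B / r\<close>.\<close>
    define t where "t = r / (2 * norm x)"
    have "t > 0"
      using False \<open>r > 0\<close> by (simp add: t_def)
    have "norm ((T ^^ n) (a + t *\<^sub>R x)) \<le> B"
      using r[of "a + t *\<^sub>R x"] False \<open>r > 0\<close> by (auto simp: dist_norm t_def not_less)
    moreover have "norm ((T ^^ n) a) \<le> B"
      using r[of a] \<open>r > 0\<close> by (auto simp: not_less)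
    moreover have "t *\<^sub>R (T ^^ n) x = (T ^^ n) (a + t *\<^sub>R x) - (T ^^ n) a"
      by (simp flip: linear_funpow_diff[OF T]
          linear_scale[OF bounded_linear.linear[OF bounded_linear_funpow[OF T]]])
    ultimately have "norm (t *\<^sub>R (T ^^ n) x) \<le> B + B"
      using norm_triangle_ineq4[of "(T ^^ n) (a + t *\<^sub>R x)" "(T ^^ n) a"] by simp
    then have "t * norm ((T ^^ n) x) \<le> 2 * B"
      using \<open>t > 0\<close> by simp
    then show ?thesis
      using False \<open>r > 0\<close> by (simp add: t_def field_simps)
  qed
  then show thesis
    by (rule that)
qed

text \<open>The parameter \<open>e\<close> is both the closeness radius and the allowed defect in
  density, so the countable family with \<open>e = 1 / real (Suc k)\<close> and \<open>N = k\<close>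
  captures all radii and defects at once.\<close>

definition often_close :: "('a::real_normed_vector \<Rightarrow> 'a) \<Rightarrow> real \<Rightarrow> nat \<Rightarrow> 'a set" where
  "often_close T e N =
     {z. \<exists>n\<ge>N. (1 - e) * real n \<le> real (card ({j. norm ((T ^^ j) z) < e} \<inter> {1..n}))}"

text \<open>Membership is witnessed by strict inequalities at the finite set \<open>J\<close> of
  times, and these persist in a neighbourhood of \<open>z\<close>.\<close>

lemma open_often_close:
  fixes T :: "'a::real_normed_vector \<Rightarrow> 'a"
  assumes "bounded_linear T"
  shows "open (often_close T e N)"
proof (subst open_subopen, intro ballI)
  fix z
  assume "z \<in> often_close T e N"
  then obtain n where n: "n \<ge> N"
      "(1 - e) * real n \<le> real (card ({j. norm ((T ^^ j) z) < e} \<inter> {1..n}))"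
    unfolding often_close_def by blast
  define J where "J = {j. norm ((T ^^ j) z) < e} \<inter> {1..n}"
  define W where "W = (\<Inter>j\<in>J. {w. norm ((T ^^ j) w) < e})"
  have "open W"
    unfolding W_def
    by (intro open_INT ballI open_Collect_less continuous_intros
        bounded_linear.continuous_on[OF bounded_linear_funpow[OF assms]]) (simp add: J_def)
  moreover have "z \<in> W"
    by (simp add: W_def J_def)
  moreover have "W \<subseteq> often_close T e N"
  proof
    fix w
    assume "w \<in> W"
    then have "J \<subseteq> {j. norm ((T ^^ j) w) < e} \<inter> {1..n}"
      by (auto simp: W_def J_def)
    then have "card J \<le> card ({j. norm ((T ^^ j) w) < e} \<inter> {1..n})"
      by (intro card_mono) auto
    then have "(1 - e) * real n \<le> real (card ({j. norm ((T ^^ j) w) < e} \<inter> {1..n}))"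
      using n(2) unfolding J_def by linarith
    then show "w \<in> often_close T e N"
      using n(1) unfolding often_close_def by blast
  qed
  ultimately show "\<exists>W. open W \<and> z \<in> W \<and> W \<subseteq> often_close T e N"
    by blast
qed

lemma orbit_tendsto_0_imp_often_close:
  assumes lim: "(\<lambda>n. (T ^^ n) x) \<longlonglongrightarrow> 0" and "e > 0"
  shows "x \<in> often_close T e N"
proof -
  obtain K where K: "\<And>j. j \<ge> K \<Longrightarrow> norm ((T ^^ j) x) < e"
    using lim \<open>e > 0\<close> unfolding LIMSEQ_iff by fastforce
  \<comment> \<open>Only times up to \<open>K\<close> can be bad; \<open>n \<ge> K / e\<close> makes
    their number at most \<open>e * real n\<close>.\<close>
  obtain n where n: "real n \<ge> max (real N) (real K / e)"
    using real_arch_simple by blast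
  have "{K + 1..n} \<subseteq> {j. norm ((T ^^ j) x) < e} \<inter> {1..n}"
    using K by auto
  then have "card {K + 1..n} \<le> card ({j. norm ((T ^^ j) x) < e} \<inter> {1..n})"
    by (intro card_mono) auto
  then have "n - K \<le> card ({j. norm ((T ^^ j) x) < e} \<inter> {1..n})"
    by simp
  moreover have "real K \<le> e * real n"
    using n \<open>e > 0\<close> by (simp add: pos_divide_le_eq mult.commute)
  ultimately have "(1 - e) * real n \<le> real (card ({j. norm ((T ^^ j) x) < e} \<inter> {1..n}))"
    by (simp add: algebra_simps)
  then show ?thesis
    using n unfolding often_close_def by auto
qed

lemma often_close_imp_upper_density:
  assumes "\<And>k. z \<in> often_close T (1 / real (Suc k)) k" and "\<delta> > 0"
  shows "upper_density {j. norm ((T ^^ j) z) < \<delta>} = 1"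
proof (rule upper_density_eq_1I)
  fix e :: real and N
  assume "e > 0"
  obtain k0 where k0: "1 / real (Suc k0) < min e \<delta>"
    using nat_approx_posE[of "min e \<delta>"] \<open>e > 0\<close> \<open>\<delta> > 0\<close> by auto
  \<comment> \<open>The part \<open>k0\<close> brings the radius and the defect below
    \<open>\<delta>\<close> and \<open>e\<close>; the part \<open>N\<close> makes the witness
    \<open>n \<ge> k\<close> late enough.\<close>
  define k where "k = max k0 N"
  define d where "d = 1 / real (Suc k)"
  have "d \<le> 1 / real (Suc k0)"
    by (auto simp: d_def k_def intro!: divide_left_mono)
  then have d: "d \<le> e" "d \<le> \<delta>"
    using k0 by auto
  obtain n where n: "n \<ge> k" "(1 - d) * real n \<le> real (card ({j. norm ((T ^^ j) z) < d} \<inter> {1..n}))"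
    using assms(1)[of k] unfolding often_close_def d_def by blast
  have "(1 - e) * real n \<le> (1 - d) * real n"
    using d by (intro mult_right_mono) auto
  also note n(2)
  also have "real (card ({j. norm ((T ^^ j) z) < d} \<inter> {1..n}))
      \<le> real (card ({j. norm ((T ^^ j) z) < \<delta>} \<inter> {1..n}))"
    using d by (intro of_nat_mono card_mono) auto
  finally show "\<exists>n\<ge>N. (1 - e) * real n \<le> real (card ({j. norm ((T ^^ j) z) < \<delta>} \<inter> {1..n}))"
    using n(1) by (auto simp: k_def)
qed

lemma exists_unbounded_often_close:
  fixes T :: "'a::banach \<Rightarrow> 'a"
  assumes T: "bounded_linear T" and dense: "closure X\<^sub>0 = UNIV"
    and lim: "\<And>x. x \<in> X\<^sub>0 \<Longrightarrow> (\<lambda>n. (T ^^ n) x) \<longlonglongrightarrow> 0"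
    and not_bdd: "\<not> (\<exists>C. \<forall>n x. norm ((T ^^ n) x) \<le> C * norm x)"
  obtains z where "\<And>B. \<exists>n. norm ((T ^^ n) z) > B"
    and "\<And>\<delta>. \<delta> > 0 \<Longrightarrow> upper_density {j. norm ((T ^^ j) z) < \<delta>} = 1"
proof -
  define U where "U k = {z. \<exists>n. norm ((T ^^ n) z) > real k}" for k
  define V where "V k = often_close T (1 / real (Suc k)) k" for k
  have opU: "open (U k)" for k
    unfolding U_def by (rule open_orbit_exceeds[OF T])
  have clU: "closure (U k) = UNIV" for k
    using not_dense_orbit_exceeds_imp_power_bounded[OF T] not_bdd unfolding U_def by metis
  have opV: "open (V k)" for k
    unfolding V_def by (rule open_often_close[OF T])
  have "X\<^sub>0 \<subseteq> V k" for k
    using orbit_tendsto_0_imp_often_close[OF lim] unfolding V_def by auto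
  then have clV: "closure (V k) = UNIV" for k
    using closure_mono dense by (metis top.extremum_uniqueI)
  have "closure (\<Inter>k. U k \<inter> V k) = UNIV"
    \<comment> \<open>Density of \<open>U k \<inter> V k\<close>: as \<open>U k\<close> is open and
      \<open>V k\<close> is dense, \<open>U k\<close> lies in the closure of the intersection, and
      \<open>U k\<close> is itself dense.\<close>
    by (intro Baire_category_open_dense open_Int opU opV)
      (metis clU clV opU open_Int_closure_subset inf_top_right closure_closure closure_mono
        top.extremum_uniqueI)
  then have "(\<Inter>k. U k \<inter> V k) \<noteq> {}"
    by auto
  then obtain z where z: "\<And>k. z \<in> U k" "\<And>k. z \<in> V k"
    by blast
  have "\<exists>n. norm ((T ^^ n) z) > B" for B
  proof -
    obtain k where "B \<le> real k"
      using real_arch_simple by blast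
    then show ?thesis
      using z(1)[of k] unfolding U_def by (auto intro: le_less_trans)
  qed
  moreover have "upper_density {j. norm ((T ^^ j) z) < \<delta>} = 1" if "\<delta> > 0" for \<delta>
    using often_close_imp_upper_density z(2) that unfolding V_def by blast
  ultimately show thesis
    by (rule that)
qed

section \<open>The two kinds of chaos\<close>

lemma Li_Yorke_chaotic_not_power_bounded:
  assumes "bounded_linear T" "Li_Yorke_chaotic T"
  shows "\<not> (\<exists>C. \<forall>n x. norm ((T ^^ n) x) \<le> C * norm x)"
proof
  assume bdd: "\<exists>C. \<forall>n x. norm ((T ^^ n) x) \<le> C * norm x"
  obtain \<Gamma> where "uncountable \<Gamma>"
    and \<Gamma>: "\<And>x y. x \<in> \<Gamma> \<Longrightarrow> y \<in> \<Gamma> \<Longrightarrow> x \<noteq> y \<Longrightarrow>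
      liminf (\<lambda>n. ereal (norm ((T ^^ n) (x - y)))) = 0 \<and>
      limsup (\<lambda>n. ereal (norm ((T ^^ n) (x - y)))) > 0"
    using assms(2) unfolding Li_Yorke_chaotic_def linear_funpow_diff[OF assms(1)] by blast
  from \<open>uncountable \<Gamma>\<close> have "infinite \<Gamma>"
    by (rule uncountable_infinite)
  then obtain x y where "x \<in> \<Gamma>" "y \<in> \<Gamma>" "x \<noteq> y"
    by (metis finite.emptyI finite_insert finite_subset insertCI subsetI)
  then show False
    using \<Gamma>[of x y] bdd power_bounded_liminf_limsup[of T _ "x - y"] by fastforce
qed

text \<open>Two distinct points of the line differ by a nonzero multiple of \<open>z\<close>, which
  only rescales the threshold \<open>\<delta>\<close> to
  \<open>\<delta> / \<bar>s - t\<bar>\<close>. Both properties of \<open>z\<close> hold at every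
  threshold, so \<open>\<epsilon> = 1\<close> serves all pairs.\<close>

lemma line_reiteratively_distributionally_chaotic:
  assumes T: "bounded_linear T" and unb: "\<And>B. \<exists>n. norm ((T ^^ n) z) > B"
    and dens: "\<And>\<delta>. \<delta> > 0 \<Longrightarrow> upper_density {j. norm ((T ^^ j) z) < \<delta>} = 1"
  shows "reiteratively_distributionally_chaotic_1plus T"
proof -
  have "z \<noteq> 0"
    using unb[of 0] by (auto simp: linear_0[OF bounded_linear.linear[OF bounded_linear_funpow[OF T]]])
  have unc: "uncountable (range (\<lambda>t. t *\<^sub>R z))"
  proof
    assume "countable (range (\<lambda>t. t *\<^sub>R z))"
    moreover have "inj (\<lambda>t. t *\<^sub>R z)"
      using \<open>z \<noteq> 0\<close> by (auto intro: injI)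
    ultimately show False
      using countable_image_inj_on uncountable_UNIV_real by blast
  qed
  have close: "close_times T (s *\<^sub>R z) (t *\<^sub>R z) \<delta> = {j. norm ((T ^^ j) z) < \<delta> / \<bar>s - t\<bar>}"
    if "s \<noteq> t" for s t \<delta>
  proof -
    have "close_times T (s *\<^sub>R z) (t *\<^sub>R z) \<delta> = close_times T ((s - t) *\<^sub>R z) 0 \<delta>"
      by (simp add: close_times_diff[OF T, of "s *\<^sub>R z"] scaleR_left_diff_distrib)
    also have "\<dots> = {j. norm ((T ^^ j) z) < \<delta> / \<bar>s - t\<bar>}"
      using that unfolding close_times_zero[OF T]
      by (simp add: linear_scale[OF bounded_linear.linear[OF bounded_linear_funpow[OF T]]]
          pos_less_divide_eq mult.commute)
    finally show ?thesis .
  qed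
  have "lower_Banach_density (close_times T (s *\<^sub>R z) (t *\<^sub>R z) 1) = 0" if "s \<noteq> t" for s t
  proof (rule lower_Banach_density_eq_0I)
    fix M n
    have "1 / \<bar>s - t\<bar> > 0"
      using that by simp
    from unbounded_orbit_long_far_windows[OF T unb this]
    obtain m where "m \<ge> M" "\<forall>j\<in>{m + 1..m + n}. 1 / \<bar>s - t\<bar> \<le> norm ((T ^^ j) z)"
      by blast
    then show "\<exists>m\<ge>M. close_times T (s *\<^sub>R z) (t *\<^sub>R z) 1 \<inter> {m + 1..m + n} = {}"
      unfolding close[OF that] by (intro exI[of _ m]) force
  qed
  moreover have "upper_density (close_times T (s *\<^sub>R z) (t *\<^sub>R z) \<delta>) = 1"
    if "s \<noteq> t" "\<delta> > 0" for s t \<delta>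
    using that by (simp add: close dens)
  ultimately show ?thesis
    using unc unfolding reiteratively_distributionally_chaotic_1plus_def
    by (intro exI[of _ "range (\<lambda>t. t *\<^sub>R z)"] exI[of _ 1]) auto
qed

text \<open>The densities say that each set of close times is infinite and that the set for
  \<open>\<epsilon>\<close> is not cofinite; these give the lower and the upper limit
  respectively.\<close>

lemma reiteratively_distributionally_chaotic_imp_Li_Yorke:
  assumes "reiteratively_distributionally_chaotic_1plus T"
  shows "Li_Yorke_chaotic T"
proof -
  obtain \<Gamma> \<epsilon> where "uncountable \<Gamma>" "\<epsilon> > 0"
    and far: "\<And>x y. x \<in> \<Gamma> \<Longrightarrow> y \<in> \<Gamma> \<Longrightarrow> x \<noteq> y \<Longrightarrow>
      lower_Banach_density (close_times T x y \<epsilon>) = 0"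
    and close: "\<And>x y \<delta>. x \<in> \<Gamma> \<Longrightarrow> y \<in> \<Gamma> \<Longrightarrow> x \<noteq> y \<Longrightarrow> \<delta> > 0 \<Longrightarrow>
      upper_density (close_times T x y \<delta>) = 1"
    using assms unfolding reiteratively_distributionally_chaotic_1plus_def by blast
  have "liminf (\<lambda>n. ereal (norm ((T ^^ n) x - (T ^^ n) y))) = 0 \<and>
      limsup (\<lambda>n. ereal (norm ((T ^^ n) x - (T ^^ n) y))) > 0"
    if xy: "x \<in> \<Gamma>" "y \<in> \<Gamma>" "x \<noteq> y" for x y
  proof
    show "liminf (\<lambda>n. ereal (norm ((T ^^ n) x - (T ^^ n) y))) = 0"
    proof (rule antisym)
      show "liminf (\<lambda>n. ereal (norm ((T ^^ n) x - (T ^^ n) y))) \<le> 0"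
      proof (rule ereal_le_epsilon2)
        fix e :: real
        assume "e > 0"
        then have "infinite (close_times T x y e)"
          using close[OF xy] upper_density_finite[of "close_times T x y e"] by auto
        then have "\<exists>\<^sub>F n in sequentially. norm ((T ^^ n) x - (T ^^ n) y) < e"
          \<comment> \<open>On the naturals, being infinite means holding frequently along the
            cofinite filter, which is \<open>sequentially\<close>.\<close>
          unfolding close_times_def frequently_cofinite[symmetric] cofinite_eq_sequentially .
        then have "\<exists>\<^sub>F n in sequentially. ereal (norm ((T ^^ n) x - (T ^^ n) y)) \<le> ereal e"
          by (rule frequently_elim1) simp
        then show "liminf (\<lambda>n. ereal (norm ((T ^^ n) x - (T ^^ n) y))) \<le> 0 + ereal e"
          by (simp add: frequently_le_imp_Liminf_le)
      qed
      show "0 \<le> liminf (\<lambda>n. ereal (norm ((T ^^ n) x - (T ^^ n) y)))"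
        by (intro Liminf_bounded always_eventually) simp
    qed
    have "infinite (- close_times T x y \<epsilon>)"
      using far[OF xy] lower_Banach_density_cofinite[of "close_times T x y \<epsilon>"] by auto
    then have "infinite {n. \<epsilon> \<le> norm ((T ^^ n) x - (T ^^ n) y)}"
      by (simp add: close_times_def Collect_neg_eq[symmetric] not_less)
    then have "\<exists>\<^sub>F n in sequentially. \<epsilon> \<le> norm ((T ^^ n) x - (T ^^ n) y)"
      unfolding frequently_cofinite[symmetric] cofinite_eq_sequentially .
    then have "\<exists>\<^sub>F n in sequentially. ereal \<epsilon> \<le> ereal (norm ((T ^^ n) x - (T ^^ n) y))"
      by simp
    then have "ereal \<epsilon> \<le> limsup (\<lambda>n. ereal (norm ((T ^^ n) x - (T ^^ n) y)))"
      by (rule frequently_ge_imp_le_Limsup)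
    then show "limsup (\<lambda>n. ereal (norm ((T ^^ n) x - (T ^^ n) y))) > 0"
      using \<open>\<epsilon> > 0\<close> by (metis ereal_less(2) less_le_trans)
  qed
  then show ?thesis
    unfolding Li_Yorke_chaotic_def using \<open>uncountable \<Gamma>\<close> by blast
qed

theorem theorem2p11:
  fixes T :: "'a::banach \<Rightarrow> 'a" and X\<^sub>0 :: "'a set"
  assumes "bounded_linear T"
    and "closure X\<^sub>0 = UNIV"
    and "\<And>x. x \<in> X\<^sub>0 \<Longrightarrow> (\<lambda>n. (T ^^ n) x) \<longlonglongrightarrow> 0"
  shows "Li_Yorke_chaotic T \<longleftrightarrow> reiteratively_distributionally_chaotic_1plus T"
proof
  assume "Li_Yorke_chaotic T"
  then obtain z where "\<And>B. \<exists>n. norm ((T ^^ n) z) > B"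
    and "\<And>\<delta>. \<delta> > 0 \<Longrightarrow> upper_density {j. norm ((T ^^ j) z) < \<delta>} = 1"
    using exists_unbounded_often_close[OF assms]
      Li_Yorke_chaotic_not_power_bounded[OF assms(1)] by blast
  then show "reiteratively_distributionally_chaotic_1plus T"
    by (rule line_reiteratively_distributionally_chaotic[OF assms(1)])
qed (rule reiteratively_distributionally_chaotic_imp_Li_Yorke)

end
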